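(* Let $\alpha\in(0,1]$, let $Z\subseteq\mathbb R^n$ be convex and $\tilde\Omega:=[a-b,b-a]$. Assume that: (a) the partial derivative $D_2\tilde f(y,\cdot):Z\to L(\mathbb R^n,\mathbb R^d)$ exists and is continuous for Lebesgue-almost all $y\in\tilde\Omega$; (b) $D_2\tilde f(\cdot,z):\tilde\Omega\to L(\mathbb R^n,\mathbb R^d)$ is measurable for all $z\in Z$, and for every $r>0$ there is an integrable function $\tilde b_r^1:\tilde\Omega\to\mathbb R_+$ such that for Lebesgue-almost all $y\in\tilde\Omega$ one has $|D_2\tilde f(y,z)|\le\tilde b_r^1(y)$ for all $z\in Z\cap\bar B_r(0)$; (c) $\tilde f:\tilde\Omega\times Z\to\mathbb R^d$ is continuous and $D_2\tilde f(\cdot,z)$ is continuous for all $z\in Z$. If $u:[a,b]\to Z$ is continuously differentiable, then also the function $\tilde{\mathscr U}(u):[a,b]\to\mathbb R^d$, $\tilde{\mathscr U}(u)(x):=\int_a^b\tilde f(x-y,u(y))\,dy$, is continuously differentiable with the derivative $$\tilde{\mathscr U}(u)'(x)=\tilde f(x-a,u(a))-\tilde f(x-b,u(b))-\int_a^bD_2\tilde f(x-y,u(y))u'(y)\,dy\quad\text{for all }x\in[a,b].$$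
   Context: $a<b$ are reals, $Z\subseteq\mathbb R^n$ is nonempty, $\tilde f:[a-b,b-a]\times Z\to\mathbb R^d$ is a function, and measurability/integrability refer to one-dimensional Lebesgue measure. The convolutive Urysohn operator $\tilde{\mathscr U}$ is considered on the set of $\alpha$-Hölder functions $u:[a,b]\to Z$, which contains the continuously differentiable ones. $\mathbb R_+=[0,\infty)$, $|\cdot|$ denotes norms on finite-dimensional spaces, $\bar B_r(0)=\{z\in\mathbb R^n:|z|\le r\}$; $L(\mathbb R^n,\mathbb R^d)$ is the space of linear maps from $\mathbb R^n$ to $\mathbb R^d$. Derivatives of $\tilde f$ in its second variable are Fréchet derivatives at interior points of $Z$; at a non-interior point $z_0\in Z$ it is assumed that $\tilde f$ has an extension to $\tilde\Omega\times(Z\cup V)$, with a neighborhood $V\subseteq\mathbb R^n$ of $z_0$, whose partial derivative exists at $z_0$ as required. At the endpoints of $[a,b]$ derivatives of functions on $[a,b]$ are one-sided.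
   Formalization: The integral term in the derivative formula is taken with a plus sign instead of the printed minus; the minus fails for f(s,z)=z, u(y)=y on [0,1], where the derivative is 0 but the printed formula gives -2. *)

theory Defs
  imports "HOL-Analysis.Analysis"
begin

text \<open>
  \<open>D\<close> is the partial derivative of \<open>f\<close> in its second variable at \<open>(y, z)\<close>, for \<open>z\<close> in \<open>Z\<close>.
  Only the values of \<open>f\<close> on \<open>\<Omega> \<times> Z\<close> matter. At a non-interior point \<open>z\<close> of \<open>Z\<close> the derivative
  is that of some extension \<open>g\<close> of \<open>f\<close> to \<open>\<Omega> \<times> (Z \<union> V)\<close> with \<open>V\<close> a neighbourhood of \<open>z\<close>
  (the values of the total function \<open>g\<close> off this set play no role). If \<open>Z\<close> has empty interior,
  \<open>D\<close> need not be unique, which is why this is a relation and not a function.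
\<close>

definition has_partial2 ::
  "real set \<Rightarrow> ('n::real_normed_vector) set \<Rightarrow> (real \<Rightarrow> 'n \<Rightarrow> 'd::real_normed_vector)
    \<Rightarrow> real \<Rightarrow> 'n \<Rightarrow> ('n \<Rightarrow>\<^sub>L 'd) \<Rightarrow> bool" where
  "has_partial2 \<Omega> Z f y z D \<longleftrightarrow>
     (if z \<in> interior Z then (f y has_derivative blinfun_apply D) (at z)
      else (\<exists>V g. open V \<and> z \<in> V \<and> (\<forall>s\<in>\<Omega>. \<forall>w\<in>Z. g s w = f s w) \<and>
                  (g y has_derivative blinfun_apply D) (at z)))"

text \<open>
  Continuous differentiability on a compact interval, with one-sided derivatives at the
  endpoints. The library predicate \<open>C1_differentiable_on\<close> uses two-sided derivatives throughout,
  so it would depend on values outside the interval.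
\<close>

definition C1_on_interval :: "real \<Rightarrow> real \<Rightarrow> (real \<Rightarrow> 'a::real_normed_vector) \<Rightarrow> bool" where
  "C1_on_interval a b u \<longleftrightarrow>
     (\<forall>x\<in>{a..b}. u differentiable (at x within {a..b})) \<and>
     continuous_on {a..b} (\<lambda>x. vector_derivative u (at x within {a..b}))"

text \<open>
  Pitfall for the derivative formula: writing the operator as the integral of \<open>f s (u (x - s))\<close>
  over \<open>s\<close> from \<open>x - b\<close> to \<open>x - a\<close> and differentiating shows that the term
  \<open>\<integral> D\<^sub>2 f (x - y, u y) (u' y) dy\<close> enters with a plus sign; the source prints a minus sign,
  which already fails for \<open>f s z = z\<close>, \<open>u y = y\<close>.
\<close>

definition urysohn_conv ::
  "real \<Rightarrow> real \<Rightarrow> (real \<Rightarrow> 'n \<Rightarrow> 'd::euclidean_space) \<Rightarrow> (real \<Rightarrow> 'n) \<Rightarrow> real \<Rightarrow> 'd" where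
  "urysohn_conv a b f u x = (\<integral>y. f (x - y) (u y) \<partial>(lebesgue_on {a..b}))"

end

theory Submission
  imports Defs
begin

text \<open>
  The substitution \<open>s = x - y\<close> moves the variable \<open>x\<close> from the first argument of \<open>f\<close>, in which \<open>f\<close> is
  merely continuous, to the second one, in which it is differentiable:
  \<open>U(u)(x) = \<integral> f s (u (x - s)) ds\<close> over \<open>s\<close> in \<open>[x - b, x - a]\<close>. Now the domain of integration
  depends on \<open>x\<close>. To separate the two dependences, extend \<open>u\<close> from \<open>[a, b]\<close> to a function \<open>v\<close> on the
  whole line that is constant, equal to \<open>u a\<close> and \<open>u b\<close>, on the two sides. Then \<open>v\<close> still takes
  values in \<open>Z\<close>, is Lipschitz, and is continuously differentiable off \<open>{a, b}\<close>. With
  \<open>H x = \<integral> f s (v (x - s)) ds\<close> over the fixed interval \<open>\<Omega> = [a - b, b - a]\<close> one gets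
  \<open>U(u)(x) = H x - \<integral> f s (u b) ds - \<integral> f s (u a) ds\<close>, the last two integrals being taken over
  \<open>[a - b, x - b]\<close> and \<open>[x - a, b - a]\<close>. The fundamental theorem of calculus differentiates these two
  (\<open>integral_shifted_endpoint_derivative\<close>) and yields the boundary terms of the formula.

  For \<open>H\<close> one differentiates under the integral sign (\<open>shifted_superposition_derivative\<close>). For almost
  every \<open>s\<close> the integrand is differentiable in \<open>x\<close> by the chain rule, since the kinks of \<open>v\<close> matter only
  for the two values of \<open>s\<close> with \<open>x - s \<in> {a, b}\<close>. By convexity of \<open>Z\<close> and the mean value inequality, its
  difference quotients are dominated by the integrable bound for \<open>D2\<close> on a ball containing the range
  of \<open>u\<close>, times the Lipschitz constant of \<open>v\<close>. Dominated convergence gives the derivative, and with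
  the same dominating function it gives the continuity of the derivative. The integrand
  \<open>s \<mapsto> D2 s (v (x - s)) (v' (x - s))\<close> is measurable because it is almost everywhere a limit of
  difference quotients, each of which is continuous in \<open>s\<close>.
\<close>

section \<open>Partial derivatives relative to a set\<close>

text \<open>
  At a non-interior point the derivative belongs to an extension of \<open>f\<close>, but the extension agrees with
  \<open>f\<close> on \<open>Z\<close>. The derivative within \<open>Z\<close> is all that the chain rule along curves in \<open>Z\<close> and the mean
  value inequality on \<open>Z\<close> ask for, and it treats both kinds of points alike.
\<close>

lemma has_partial2_imp_within:
  assumes "has_partial2 \<Omega> Z f y z D" "y \<in> \<Omega>" "z \<in> Z"
  shows "(f y has_derivative blinfun_apply D) (at z within Z)"
proof (cases "z \<in> interior Z")
  case True
  with assms show ?thesis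
    unfolding has_partial2_def by (auto intro: has_derivative_at_withinI)
next
  case False
  with assms obtain g where eq: "\<forall>s\<in>\<Omega>. \<forall>w\<in>Z. g s w = f s w"
    and der: "(g y has_derivative blinfun_apply D) (at z)"
    unfolding has_partial2_def by auto
  have "(g y has_derivative blinfun_apply D) (at z within Z)"
    using der by (rule has_derivative_at_withinI)
  then show ?thesis
    using has_derivative_transform[of z Z "f y" "g y" "blinfun_apply D"] eq assms by simp
qed

section \<open>Differentiation under the integral sign\<close>

lemma has_vector_derivative_iff_slope:
  fixes f :: "real \<Rightarrow> 'a::real_normed_vector"
  shows "(f has_vector_derivative D) (at x within X) \<longleftrightarrow>
    ((\<lambda>y. (f y - f x) /\<^sub>R (y - x)) \<longlongrightarrow> D) (at x within X)"
proof -
  have "norm (f y - f x - (y - x) *\<^sub>R D) / norm (y - x) = norm ((f y - f x) /\<^sub>R (y - x) - D)"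
    if "y \<noteq> x" for y
  proof -
    have "(f y - f x) /\<^sub>R (y - x) - D = (f y - f x - (y - x) *\<^sub>R D) /\<^sub>R (y - x)"
      using that by (simp add: scaleR_diff_right)
    then show ?thesis
      by (simp add: divide_inverse mult.commute)
  qed
  then have "((\<lambda>y. norm (f y - f x - (y - x) *\<^sub>R D) / norm (y - x)) \<longlongrightarrow> 0) (at x within X)
     \<longleftrightarrow> ((\<lambda>y. norm ((f y - f x) /\<^sub>R (y - x) - D)) \<longlongrightarrow> 0) (at x within X)"
    by (intro tendsto_cong) (auto simp: eventually_at_filter)
  then show ?thesis
    by (simp add: has_vector_derivative_def has_derivative_iff_norm bounded_linear_scaleR_left
        tendsto_norm_zero_iff LIM_zero_iff)
qed

lemma AE_lebesgue_on_negligible: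
  assumes "S \<in> sets lebesgue" "AE s in lebesgue_on S. P s"
  obtains N where "negligible N" "\<And>s. s \<in> S - N \<Longrightarrow> P s"
proof -
  have "AE s in lebesgue. s \<in> S \<longrightarrow> P s"
    using assms AE_restrict_space_iff[of S lebesgue P] by simp
  then have "negligible {s. \<not> (s \<in> S \<longrightarrow> P s)}"
    unfolding negligible_iff_null_sets
    by (simp add: completion.AE_iff_null_sets)
  then show ?thesis by (rule that) auto
qed

text \<open>
  By completeness of Lebesgue measure, the limit function may be arbitrary on the exceptional null set.
\<close>

lemma borel_measurable_lebesgue_on_AE_limit:
  fixes g :: "nat \<Rightarrow> 'a::euclidean_space \<Rightarrow> 'b::euclidean_space"
  assumes "S \<in> sets lebesgue" "\<And>n. g n \<in> borel_measurable (lebesgue_on S)"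
    and lim: "AE s in lebesgue_on S. (\<lambda>n. g n s) \<longlonglongrightarrow> h s"
  shows "h \<in> borel_measurable (lebesgue_on S)"
proof -
  obtain N where "negligible N" "\<And>s. s \<in> S - N \<Longrightarrow> (\<lambda>n. g n s) \<longlonglongrightarrow> h s"
    using AE_lebesgue_on_negligible[OF assms(1) lim] by blast
  then have "h measurable_on S"
    using measurable_on_limit[of g S N h] assms(1,2)
    by (simp add: measurable_on_iff_borel_measurable)
  then show ?thesis
    using assms(1) by (simp add: measurable_on_iff_borel_measurable)
qed

text \<open>
  The Lipschitz bound \<open>L\<close> is a dominating function for the difference quotients at \<open>x0\<close>. Differentiability
  is required at \<open>x0\<close> only and for almost every \<open>s\<close>, so the exceptional set may move with \<open>x0\<close>; this is
  what admits integrands \<open>g x s\<close> with a kink along a line in the \<open>(x, s)\<close> plane. That \<open>x0\<close> is a limit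
  point of \<open>X\<close> provides a sequence of difference quotients, from which \<open>g'\<close> inherits measurability.
\<close>

lemma has_vector_derivative_integral_dominated:
  fixes g :: "real \<Rightarrow> 'a::euclidean_space \<Rightarrow> 'b::euclidean_space"
  assumes S: "S \<in> sets lebesgue"
    and int: "\<And>x. x \<in> X \<Longrightarrow> integrable (lebesgue_on S) (g x)"
    and L: "integrable (lebesgue_on S) L"
    and lip: "AE s in lebesgue_on S. \<forall>x\<in>X. norm (g x s - g x0 s) \<le> L s * \<bar>x - x0\<bar>"
    and der: "AE s in lebesgue_on S. ((\<lambda>x. g x s) has_vector_derivative g' s) (at x0 within X)"
    and x0: "x0 \<in> X" "x0 islimpt X"
  shows "integrable (lebesgue_on S) g'"
    and "((\<lambda>x. \<integral>s. g x s \<partial>lebesgue_on S) has_vector_derivative (\<integral>s. g' s \<partial>lebesgue_on S))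
      (at x0 within X)"
proof -
  define q where "q x s = (g x s - g x0 s) /\<^sub>R (x - x0)" for x s
  have q_int: "integrable (lebesgue_on S) (q x)" if "x \<in> X" for x
    unfolding q_def using int that x0 by auto
  have q_lim: "AE s in lebesgue_on S. (\<lambda>n. q (\<xi> n) s) \<longlonglongrightarrow> g' s"
    if "\<And>n. \<xi> n \<in> X - {x0}" "\<xi> \<longlonglongrightarrow> x0" for \<xi>
    using der
  proof eventually_elim
    case (elim s)
    then show ?case
      using that unfolding has_vector_derivative_iff_slope q_def tendsto_at_iff_sequentially o_def
      by blast
  qed
  have q_bound: "AE s in lebesgue_on S. norm (q x s) \<le> L s" if "x \<in> X - {x0}" for x
    using lip
  proof eventually_elim
    case (elim s)
    have "\<bar>x - x0\<bar> > 0" "x \<in> X" using that by auto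
    with elim show ?case by (auto simp: q_def divide_simps mult.commute)
  qed
  have meas: "g' \<in> borel_measurable (lebesgue_on S)"
  proof -
    obtain \<xi> where \<xi>: "\<And>n. \<xi> n \<in> X - {x0}" "\<xi> \<longlonglongrightarrow> x0"
      using x0(2) unfolding islimpt_sequential by auto
    show ?thesis
      by (rule borel_measurable_lebesgue_on_AE_limit[OF S _ q_lim[OF \<xi>]])
        (use q_int \<xi>(1) in auto)
  qed
  have dct: "integrable (lebesgue_on S) g' \<and>
      (\<lambda>n. \<integral>s. q (\<xi> n) s \<partial>lebesgue_on S) \<longlonglongrightarrow> (\<integral>s. g' s \<partial>lebesgue_on S)"
    if \<xi>: "\<And>n. \<xi> n \<in> X - {x0}" "\<xi> \<longlonglongrightarrow> x0" for \<xi>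
  proof
    have m: "q (\<xi> n) \<in> borel_measurable (lebesgue_on S)" for n
      using q_int \<xi>(1)[of n] by auto
    show "integrable (lebesgue_on S) g'"
      by (rule integrable_dominated_convergence[where s = "\<lambda>n. q (\<xi> n)",
            OF meas m L q_lim[OF \<xi>] q_bound[OF \<xi>(1)]])
    show "(\<lambda>n. \<integral>s. q (\<xi> n) s \<partial>lebesgue_on S) \<longlonglongrightarrow> (\<integral>s. g' s \<partial>lebesgue_on S)"
      by (rule integral_dominated_convergence[where s = "\<lambda>n. q (\<xi> n)",
            OF meas m L q_lim[OF \<xi>] q_bound[OF \<xi>(1)]])
  qed
  obtain \<xi>0 where "\<And>n. \<xi>0 n \<in> X - {x0}" "\<xi>0 \<longlonglongrightarrow> x0"
    using x0(2) unfolding islimpt_sequential by auto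
  then show "integrable (lebesgue_on S) g'" using dct by blast
  have "(\<integral>s. q x s \<partial>lebesgue_on S)
      = ((\<integral>s. g x s \<partial>lebesgue_on S) - (\<integral>s. g x0 s \<partial>lebesgue_on S)) /\<^sub>R (x - x0)"
    if "x \<in> X" for x
    unfolding q_def using int that x0 by (subst integral_scaleR_right) auto
  then show "((\<lambda>x. \<integral>s. g x s \<partial>lebesgue_on S) has_vector_derivative (\<integral>s. g' s \<partial>lebesgue_on S))
      (at x0 within X)"
    unfolding has_vector_derivative_iff_slope tendsto_at_iff_sequentially o_def
    using dct by auto
qed

section \<open>Reflection of the variable of integration\<close>

lemma lebesgue_integral_reflect_shift:
  fixes h :: "real \<Rightarrow> 'b::euclidean_space"
  assumes "integrable lebesgue h"
  shows "integrable lebesgue (\<lambda>y. h (x - y))"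
    and "(\<integral>y. h (x - y) \<partial>lebesgue) = (\<integral>s. h s \<partial>lebesgue)"
proof -
  have "has_bochner_integral lebesgue (\<lambda>y. h (x - y)) (\<integral>s. h s \<partial>lebesgue)"
    using has_bochner_integral_lebesgue_real_affine_iff[of "-1" h "\<integral>s. h s \<partial>lebesgue" x]
      has_bochner_integral_integrable[OF assms] by simp
  then show "integrable lebesgue (\<lambda>y. h (x - y))"
    and "(\<integral>y. h (x - y) \<partial>lebesgue) = (\<integral>s. h s \<partial>lebesgue)"
    by (auto simp: has_bochner_integral_iff)
qed

lemma lebesgue_on_interval_reflect_shift:
  fixes h :: "real \<Rightarrow> 'b::euclidean_space"
  assumes "integrable (lebesgue_on {x - b..x - a}) h"
  shows "integrable (lebesgue_on {a..b}) (\<lambda>y. h (x - y))"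
    and "(\<integral>y. h (x - y) \<partial>lebesgue_on {a..b}) = (\<integral>s. h s \<partial>lebesgue_on {x - b..x - a})"
proof -
  have ind: "indicator {x - b..x - a} (x - y) = (indicator {a..b} y :: real)" for y
    by (auto simp: indicator_def)
  note int = lebesgue_integral_reflect_shift[of "\<lambda>s. indicator {x - b..x - a} s *\<^sub>R h s" x]
  show "integrable (lebesgue_on {a..b}) (\<lambda>y. h (x - y))"
    and "(\<integral>y. h (x - y) \<partial>lebesgue_on {a..b}) = (\<integral>s. h s \<partial>lebesgue_on {x - b..x - a})"
    using int assms by (simp_all add: integrable_restrict_space integral_restrict_space ind)
qed

section \<open>Superposition with a shifted piecewise smooth curve\<close>

lemma AE_lebesgue_on_shift_notin_finite:
  fixes x :: real
  assumes "finite N" "S \<in> sets lebesgue"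
  shows "AE s in lebesgue_on S. x - s \<notin> N"
proof -
  have "{s. x - s \<in> N} = (\<lambda>t. x - t) ` N"
    by (force simp: image_iff)
  then have "{s. x - s \<in> N} \<in> null_sets lebesgue"
    using assms(1) negligible_finite[of "(\<lambda>t. x - t) ` N"] by (simp add: negligible_iff_null_sets)
  then have "AE s in lebesgue. x - s \<notin> N"
    using AE_not_in[of "{s. x - s \<in> N}" lebesgue] by simp
  then show ?thesis
    using assms(2) by (simp add: AE_restrict_space_iff) (auto elim: eventually_mono)
qed

text \<open>
  The curve \<open>v\<close> may have kinks at the points of a finite set \<open>N\<close>: for fixed \<open>x\<close> they influence the
  integrand only where \<open>x - s \<in> N\<close>, which is a null set of \<open>s\<close>. All limits below are dominated by
  \<open>\<lambda>s. \<beta> s * M\<close>, where \<open>M\<close> bounds both the slopes of \<open>v\<close> and the values of \<open>w\<close>; the convexity of \<open>W\<close> turns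
  the bound \<open>\<beta> s\<close> of the derivative of \<open>f s\<close> into a Lipschitz constant.
\<close>

lemma shifted_superposition_derivative:
  fixes f :: "real \<Rightarrow> 'n::euclidean_space \<Rightarrow> 'd::euclidean_space"
    and D :: "real \<Rightarrow> 'n \<Rightarrow> 'n \<Rightarrow>\<^sub>L 'd"
  assumes f: "continuous_on ({c..d} \<times> W) (\<lambda>(s, z). f s z)"
    and W: "convex W"
    and D: "AE s in lebesgue_on {c..d}.
      (\<forall>z\<in>W. (f s has_derivative D s z) (at z within W)) \<and> continuous_on W (D s)"
    and \<beta>: "integrable (lebesgue_on {c..d}) \<beta>"
      "AE s in lebesgue_on {c..d}. \<forall>z\<in>W. norm (D s z) \<le> \<beta> s"
    and v: "\<And>t. v t \<in> W" "\<And>t t'. norm (v t - v t') \<le> M * \<bar>t - t'\<bar>"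
    and N: "finite N" "\<And>t. t \<notin> N \<Longrightarrow> (v has_vector_derivative w t) (at t)"
      "\<And>t. t \<notin> N \<Longrightarrow> isCont w t"
    and w: "\<And>t. norm (w t) \<le> M"
  shows "continuous_on {c..d} (\<lambda>s. f s (v (x - s)))"
    and "integrable (lebesgue_on {c..d}) (\<lambda>s. D s (v (x - s)) (w (x - s)))"
    and "((\<lambda>x. \<integral>s. f s (v (x - s)) \<partial>lebesgue_on {c..d}) has_vector_derivative
      (\<integral>s. D s (v (x - s)) (w (x - s)) \<partial>lebesgue_on {c..d})) (at x)"
    and "continuous_on UNIV (\<lambda>x. \<integral>s. D s (v (x - s)) (w (x - s)) \<partial>lebesgue_on {c..d})"
proof -
  have M: "0 \<le> M"
    using norm_ge_zero w order_trans by blast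
  have v_cont: "continuous_on UNIV v"
    by (rule lipschitz_on_continuous_on[of M], rule lipschitz_onI) (use v M in \<open>auto simp: dist_norm\<close>)
  have f_cont: "continuous_on {c..d} (\<lambda>s. f s (v (x - s)))" for x
  proof -
    have "continuous_on {c..d} (\<lambda>s. (\<lambda>(s, z). f s z) (s, v (x - s)))"
      by (rule continuous_on_compose2[OF f])
        (use v in \<open>auto intro!: continuous_intros continuous_on_compose2[OF v_cont]\<close>)
    then show ?thesis by simp
  qed
  then show "continuous_on {c..d} (\<lambda>s. f s (v (x - s)))" .
  have off_N: "AE s in lebesgue_on {c..d}. x - s \<notin> N" for x
    using N(1) by (rule AE_lebesgue_on_shift_notin_finite) auto
  have lip: "AE s in lebesgue_on {c..d}. \<forall>x\<in>UNIV.
      norm (f s (v (x - s)) - f s (v (x0 - s))) \<le> \<beta> s * M * \<bar>x - x0\<bar>" for x0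
    using D \<beta>(2)
  proof eventually_elim
    case (elim s)
    show ?case
    proof
      fix x
      have "0 \<le> \<beta> s"
        using elim(2) v(1) norm_ge_zero order_trans by blast
      have "norm (f s (v (x - s)) - f s (v (x0 - s))) \<le> \<beta> s * norm (v (x - s) - v (x0 - s))"
        by (rule differentiable_bound[OF W])
          (use elim v in \<open>auto simp: norm_blinfun.rep_eq[symmetric]\<close>)
      also have "\<dots> \<le> \<beta> s * (M * \<bar>x - x0\<bar>)"
        using v(2)[of "x - s" "x0 - s"] \<open>0 \<le> \<beta> s\<close> by (intro mult_left_mono) auto
      finally show "norm (f s (v (x - s)) - f s (v (x0 - s))) \<le> \<beta> s * M * \<bar>x - x0\<bar>"
        by (simp add: mult.assoc)
    qed
  qed
  have der: "AE s in lebesgue_on {c..d}.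
      ((\<lambda>x. f s (v (x - s))) has_vector_derivative D s (v (x - s)) (w (x - s))) (at x)" for x
    using D off_N[of x]
  proof eventually_elim
    case (elim s)
    have "((\<lambda>x. v (x - s)) has_derivative (\<lambda>h. h *\<^sub>R w (x - s))) (at x)"
      by (rule has_derivative_compose[of "\<lambda>x. x - s" "\<lambda>h. h"])
        (use N(2) elim in \<open>auto intro!: derivative_eq_intros simp: has_vector_derivative_def\<close>)
    then have "((\<lambda>x. f s (v (x - s))) has_derivative (\<lambda>h. D s (v (x - s)) (h *\<^sub>R w (x - s))))
        (at x within UNIV)"
      by (intro has_derivative_in_compose2[of W "f s" "D s" "\<lambda>x. v (x - s)"]) (use elim v in auto)
    then show ?case
      by (simp add: has_vector_derivative_def blinfun.scaleR_right)
  qed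
  have *: "integrable (lebesgue_on {c..d}) (\<lambda>s. D s (v (x - s)) (w (x - s)))"
    "((\<lambda>x. \<integral>s. f s (v (x - s)) \<partial>lebesgue_on {c..d}) has_vector_derivative
      (\<integral>s. D s (v (x - s)) (w (x - s)) \<partial>lebesgue_on {c..d})) (at x)" for x
  proof -
    have S: "{c..d} \<in> sets lebesgue" by auto
    have int: "integrable (lebesgue_on {c..d}) (\<lambda>s. f s (v (y - s)))" for y
      using f_cont by (rule continuous_imp_integrable_real)
    have L: "integrable (lebesgue_on {c..d}) (\<lambda>s. \<beta> s * M)"
      using \<beta>(1) by auto
    show "integrable (lebesgue_on {c..d}) (\<lambda>s. D s (v (x - s)) (w (x - s)))"
      "((\<lambda>x. \<integral>s. f s (v (x - s)) \<partial>lebesgue_on {c..d}) has_vector_derivative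
      (\<integral>s. D s (v (x - s)) (w (x - s)) \<partial>lebesgue_on {c..d})) (at x)"
      using has_vector_derivative_integral_dominated[OF S int L lip der, of x] by auto
  qed
  then show "integrable (lebesgue_on {c..d}) (\<lambda>s. D s (v (x - s)) (w (x - s)))"
    "((\<lambda>x. \<integral>s. f s (v (x - s)) \<partial>lebesgue_on {c..d}) has_vector_derivative
      (\<integral>s. D s (v (x - s)) (w (x - s)) \<partial>lebesgue_on {c..d})) (at x)" by this+
  show "continuous_on UNIV (\<lambda>x. \<integral>s. D s (v (x - s)) (w (x - s)) \<partial>lebesgue_on {c..d})"
    unfolding continuous_on_sequentially o_def
  proof safe
    fix \<xi> :: "nat \<Rightarrow> real" and x
    assume \<xi>: "\<xi> \<longlonglongrightarrow> x"
    show "(\<lambda>n. \<integral>s. D s (v (\<xi> n - s)) (w (\<xi> n - s)) \<partial>lebesgue_on {c..d})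
        \<longlonglongrightarrow> (\<integral>s. D s (v (x - s)) (w (x - s)) \<partial>lebesgue_on {c..d})"
    proof (rule integral_dominated_convergence)
      show "integrable (lebesgue_on {c..d}) (\<lambda>s. \<beta> s * M)"
        using \<beta>(1) by auto
      show "AE s in lebesgue_on {c..d}.
          (\<lambda>n. D s (v (\<xi> n - s)) (w (\<xi> n - s))) \<longlonglongrightarrow> D s (v (x - s)) (w (x - s))"
        using D off_N[of x]
      proof eventually_elim
        case (elim s)
        have arg: "(\<lambda>n. \<xi> n - s) \<longlonglongrightarrow> x - s"
          using \<xi> by (intro tendsto_intros)
        have "(\<lambda>n. v (\<xi> n - s)) \<longlonglongrightarrow> v (x - s)"
          by (rule continuous_on_tendsto_compose[OF v_cont arg]) auto
        then have "(\<lambda>n. D s (v (\<xi> n - s))) \<longlonglongrightarrow> D s (v (x - s))"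
          by (intro continuous_on_tendsto_compose[where f = "D s" and s = W]) (use elim v in auto)
        moreover have "(\<lambda>n. w (\<xi> n - s)) \<longlonglongrightarrow> w (x - s)"
          by (rule isCont_tendsto_compose[OF N(3)[OF elim(2)] arg])
        ultimately show ?case by (rule blinfun.tendsto)
      qed
      show "AE s in lebesgue_on {c..d}. norm (D s (v (\<xi> n - s)) (w (\<xi> n - s))) \<le> \<beta> s * M" for n
        using \<beta>(2)
      proof eventually_elim
        case (elim s)
        have "norm (D s (v (\<xi> n - s)) (w (\<xi> n - s))) \<le> norm (D s (v (\<xi> n - s))) * norm (w (\<xi> n - s))"
          by (rule norm_blinfun)
        also have "\<dots> \<le> \<beta> s * M"
        proof (rule mult_mono)
          show bound: "norm (D s (v (\<xi> n - s))) \<le> \<beta> s" using elim v by blast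
          show "0 \<le> \<beta> s" using bound norm_ge_zero order_trans by blast
        qed (use w in auto)
        finally show ?case .
      qed
    qed (use *(1) in auto)
  qed
qed

section \<open>Constant extension of a curve beyond its interval\<close>

definition clamped :: "real \<Rightarrow> real \<Rightarrow> (real \<Rightarrow> 'a) \<Rightarrow> real \<Rightarrow> 'a" where
  "clamped a b u t = u (max a (min b t))"

lemma clamped_simps:
  "t \<in> {a..b} \<Longrightarrow> clamped a b u t = u t"
  "a \<le> b \<Longrightarrow> t \<le> a \<Longrightarrow> clamped a b u t = u a"
  "a \<le> b \<Longrightarrow> b \<le> t \<Longrightarrow> clamped a b u t = u b"
  by (auto simp: clamped_def max_def min_def intro!: arg_cong[of _ _ u])

lemma clamped_lipschitz:
  fixes u :: "real \<Rightarrow> 'a::real_normed_vector"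
  assumes "a \<le> b"
    and u: "\<And>t. t \<in> {a..b} \<Longrightarrow> (u has_vector_derivative u' t) (at t within {a..b})"
    and M: "\<And>t. t \<in> {a..b} \<Longrightarrow> norm (u' t) \<le> M"
  shows "norm (clamped a b u t - clamped a b u t') \<le> M * \<bar>t - t'\<bar>"
proof -
  have "0 \<le> M"
    using M[of a] \<open>a \<le> b\<close> norm_ge_zero[of "u' a"] by (simp del: norm_ge_zero)
  have "norm (clamped a b u t - clamped a b u t')
      \<le> M * norm (max a (min b t) - max a (min b t'))"
    unfolding clamped_def
  proof (rule differentiable_bound[of "{a..b}" u "\<lambda>t h. h *\<^sub>R u' t"])
    show "onorm (\<lambda>h. h *\<^sub>R u' t) \<le> M" if "t \<in> {a..b}" for t
      using M[OF that] onorm_scaleR_left[of "\<lambda>h::real. h" "u' t"]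
      by (simp add: onorm_id bounded_linear_ident)
  qed (use u \<open>a \<le> b\<close> in \<open>auto simp: has_vector_derivative_def\<close>)
  also have "\<dots> \<le> M * \<bar>t - t'\<bar>"
    using \<open>0 \<le> M\<close> by (intro mult_left_mono) (auto simp: max_def min_def)
  finally show ?thesis .
qed

text \<open>
  On each of the three open intervals that \<open>a\<close> and \<open>b\<close> cut out of the line, the extension is
  continuously differentiable. At \<open>a\<close> and \<open>b\<close> it has kinks unless the one-sided derivatives vanish.
\<close>

lemma clamped_derivative:
  fixes u :: "real \<Rightarrow> 'a::real_normed_vector"
  assumes "a \<le> b"
    and u: "\<And>t. t \<in> {a..b} \<Longrightarrow> (u has_vector_derivative u' t) (at t within {a..b})"
    and u': "continuous_on {a..b} u'"
    and t: "t \<notin> {a, b}"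
  defines "w \<equiv> \<lambda>t. if t \<in> {a..b} then u' t else 0"
  shows "(clamped a b u has_vector_derivative w t) (at t)" and "isCont w t"
proof -
  consider "t < a" | "a < t" "t < b" | "b < t"
    using t by fastforce
  then have "(clamped a b u has_vector_derivative w t) (at t) \<and> isCont w t"
  proof cases
    case 1
    have "(clamped a b u has_vector_derivative 0) (at t)"
      by (rule has_vector_derivative_transform_within_open[of "\<lambda>_. u a" _ _ "{..<a}"])
        (use 1 \<open>a \<le> b\<close> in \<open>auto simp: clamped_simps\<close>)
    moreover have "continuous_on {..<a} w"
      by (rule continuous_on_eq[of _ "\<lambda>_. 0"]) (auto simp: w_def)
    ultimately show ?thesis
      using 1 by (auto simp: w_def continuous_on_eq_continuous_at)
  next
    case 2
    have "(u has_vector_derivative u' t) (at t)"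
      using u[of t] 2 by (simp add: at_within_Icc_at)
    then have "(clamped a b u has_vector_derivative u' t) (at t)"
      by (rule has_vector_derivative_transform_within_open[of _ _ _ "{a<..<b}"])
        (use 2 in \<open>auto simp: clamped_simps\<close>)
    moreover have "continuous_on {a<..<b} w"
      by (rule continuous_on_eq[of _ u'])
        (auto simp: w_def intro: continuous_on_subset[OF u'])
    ultimately show ?thesis
      using 2 by (auto simp: w_def continuous_on_eq_continuous_at)
  next
    case 3
    have "(clamped a b u has_vector_derivative 0) (at t)"
      by (rule has_vector_derivative_transform_within_open[of "\<lambda>_. u b" _ _ "{b<..}"])
        (use 3 \<open>a \<le> b\<close> in \<open>auto simp: clamped_simps\<close>)
    moreover have "continuous_on {b<..} w"
      by (rule continuous_on_eq[of _ "\<lambda>_. 0"]) (auto simp: w_def)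
    ultimately show ?thesis
      using 3 by (auto simp: w_def continuous_on_eq_continuous_at)
  qed
  then show "(clamped a b u has_vector_derivative w t) (at t)" "isCont w t"
    by auto
qed

section \<open>Differentiability of the convolutive Urysohn operator\<close>

lemma integral_shifted_endpoint_derivative:
  fixes g :: "real \<Rightarrow> 'd::banach"
  assumes g: "continuous_on {c..d} g" and x: "x \<in> X" "\<And>x. x \<in> X \<Longrightarrow> x - e \<in> {c..d}"
  shows "((\<lambda>x. integral {c..x - e} g) has_vector_derivative g (x - e)) (at x within X)"
proof -
  have "((\<lambda>x. integral {c..x} g) has_vector_derivative g (x - e))
      (at (x - e) within (\<lambda>x. x - e) ` X)"
    by (rule has_vector_derivative_within_subset[OF integral_has_vector_derivative[OF g]])
      (use x in auto)
  then have "((\<lambda>x. integral {c..x} g) \<circ> (\<lambda>x. x - e) has_vector_derivative 1 *\<^sub>R g (x - e))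
      (at x within X)"
    by (rule vector_diff_chain_within[rotated]) (auto intro!: derivative_eq_intros)
  then show ?thesis by (simp add: o_def)
qed

theorem theorem2p15:
  fixes a b \<alpha> :: real
    and Z :: "(real ^ 'n) set"
    and f :: "real \<Rightarrow> real ^ 'n \<Rightarrow> real ^ 'd"
    and D2 :: "real \<Rightarrow> real ^ 'n \<Rightarrow> ((real ^ 'n) \<Rightarrow>\<^sub>L (real ^ 'd))"
    and \<Omega> :: "real set"
    and u :: "real \<Rightarrow> real ^ 'n"
  assumes "a < b"
    and "0 < \<alpha>" and "\<alpha> \<le> 1"
    and "Z \<noteq> {}" and "convex Z"
    and "\<Omega> = {a - b..b - a}"
    and a: "AE y in lebesgue_on \<Omega>. (\<forall>z\<in>Z. has_partial2 \<Omega> Z f y z (D2 y z)) \<and> continuous_on Z (D2 y)"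
    and b_measurable: "\<forall>z\<in>Z. (\<lambda>y. D2 y z) \<in> borel_measurable (lebesgue_on \<Omega>)"
    and b_bound: "\<forall>r>0. \<exists>\<beta> :: real \<Rightarrow> real.
           integrable (lebesgue_on \<Omega>) \<beta> \<and> (\<forall>y\<in>\<Omega>. 0 \<le> \<beta> y) \<and>
           (AE y in lebesgue_on \<Omega>. \<forall>z\<in>Z \<inter> cball 0 r. norm (D2 y z) \<le> \<beta> y)"
    and c_f: "continuous_on (\<Omega> \<times> Z) (\<lambda>(y, z). f y z)"
    and c_D2: "\<forall>z\<in>Z. (\<forall>y\<in>\<Omega>. has_partial2 \<Omega> Z f y z (D2 y z)) \<and> continuous_on \<Omega> (\<lambda>y. D2 y z)"
    and "\<forall>x\<in>{a..b}. u x \<in> Z"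
    and "C1_on_interval a b u"
  shows "(\<forall>x\<in>{a..b}. integrable (lebesgue_on {a..b}) (\<lambda>y. f (x - y) (u y))) \<and>
    C1_on_interval a b (urysohn_conv a b f u) \<and>
    (\<forall>x\<in>{a..b}.
       integrable (lebesgue_on {a..b})
         (\<lambda>y. blinfun_apply (D2 (x - y) (u y)) (vector_derivative u (at y within {a..b}))) \<and>
       (urysohn_conv a b f u has_vector_derivative
          (f (x - a) (u a) - f (x - b) (u b)
           + (\<integral>y. blinfun_apply (D2 (x - y) (u y)) (vector_derivative u (at y within {a..b}))
                \<partial>(lebesgue_on {a..b}))))
         (at x within {a..b}))"
proof -
  define u' where "u' t = vector_derivative u (at t within {a..b})" for t
  define v where "v = clamped a b u"
  define w where "w t = (if t \<in> {a..b} then u' t else 0)" for t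
  have u: "(u has_vector_derivative u' t) (at t within {a..b})" if "t \<in> {a..b}" for t
    using \<open>C1_on_interval a b u\<close> that
    by (simp add: C1_on_interval_def u'_def vector_derivative_works)
  have u'_cont: "continuous_on {a..b} u'"
    using \<open>C1_on_interval a b u\<close> by (simp add: C1_on_interval_def u'_def[abs_def])
  obtain M where M: "\<And>t. t \<in> {a..b} \<Longrightarrow> norm (u' t) \<le> M" "0 < M"
    using compact_imp_bounded[OF compact_continuous_image[OF u'_cont compact_Icc]]
    unfolding bounded_pos by blast
  have u_cont: "continuous_on {a..b} u"
    using u by (rule continuous_on_vector_derivative)
  obtain r where r: "\<And>t. t \<in> {a..b} \<Longrightarrow> norm (u t) \<le> r" "0 < r"
    using compact_imp_bounded[OF compact_continuous_image[OF u_cont compact_Icc]]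
    unfolding bounded_pos by blast
  \<comment> \<open>For almost every \<open>s\<close> one integrable \<open>\<beta>\<close> bounds \<open>D2 s\<close> on all of \<open>W\<close>, which is still convex.\<close>
  define W where "W = Z \<inter> cball 0 r"
  have u_W: "u t \<in> W" if "t \<in> {a..b}" for t
    using that r assms(12) by (auto simp: W_def)
  have v_W: "v t \<in> W" for t
    unfolding v_def clamped_def by (rule u_W) (use \<open>a < b\<close> in auto)
  obtain \<beta> where \<beta>: "integrable (lebesgue_on \<Omega>) \<beta>"
      "AE s in lebesgue_on \<Omega>. \<forall>z\<in>W. norm (D2 s z) \<le> \<beta> s"
    using b_bound r(2) unfolding W_def by blast
  have f_cont: "continuous_on (\<Omega> \<times> W) (\<lambda>(s, z). f s z)"
    using c_f by (rule continuous_on_subset) (auto simp: W_def)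
  have der: "AE s in lebesgue_on \<Omega>. (\<forall>z\<in>W. (f s has_derivative D2 s z) (at z within W)) \<and>
      continuous_on W (D2 s)"
    using a AE_space
  proof eventually_elim
    case (elim s)
    have "(f s has_derivative D2 s z) (at z within W)" if "z \<in> W" for z
    proof (rule has_derivative_subset)
      show "(f s has_derivative D2 s z) (at z within Z)"
        using elim that by (intro has_partial2_imp_within[of \<Omega>]) (auto simp: W_def)
    qed (auto simp: W_def)
    with elim show ?case
      by (auto simp: W_def intro: continuous_on_subset)
  qed
  have "convex W"
    using \<open>convex Z\<close> by (simp add: W_def convex_Int)
  have v_der: "(v has_vector_derivative w t) (at t)" "isCont w t" if "t \<notin> {a, b}" for t
    using clamped_derivative[OF _ u u'_cont that] \<open>a < b\<close> by (auto simp: v_def w_def[abs_def])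
  have v_lip: "norm (v t - v t') \<le> M * \<bar>t - t'\<bar>" for t t'
    unfolding v_def using \<open>a < b\<close> u M(1) by (intro clamped_lipschitz) auto
  have w_le: "norm (w t) \<le> M" for t
    using M by (auto simp: w_def)
  note core = shifted_superposition_derivative[where N = "{a, b}", OF f_cont[unfolded \<open>\<Omega> = _\<close>] \<open>convex W\<close>
      der[unfolded \<open>\<Omega> = _\<close>] \<beta>[unfolded \<open>\<Omega> = _\<close>] v_W v_lip _ v_der w_le, simplified]

  define H where "H x = (\<integral>s. f s (v (x - s)) \<partial>lebesgue_on \<Omega>)" for x
  define K where "K x = (\<integral>s. D2 s (v (x - s)) (w (x - s)) \<partial>lebesgue_on \<Omega>)" for x

  have K: "integrable (lebesgue_on {a..b}) (\<lambda>y. D2 (x - y) (u y) (u' y))"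
    "(\<integral>y. D2 (x - y) (u y) (u' y) \<partial>lebesgue_on {a..b}) = K x" if x: "x \<in> {a..b}" for x
  proof -
    define k where "k s = D2 s (v (x - s)) (w (x - s))" for s
    have k: "integrable (lebesgue_on \<Omega>) k"
      unfolding k_def \<open>\<Omega> = _\<close> by (rule core)
    have \<Omega>_meas: "\<Omega> \<in> sets lebesgue"
      by (simp add: \<open>\<Omega> = _\<close>)
    \<comment> \<open>The constant pieces of \<open>v\<close> have derivative \<open>w = 0\<close>, so only \<open>s\<close> in \<open>[x - b, x - a]\<close> contribute.\<close>
    have ind: "indicator \<Omega> s *\<^sub>R k s = indicator {x - b..x - a} s *\<^sub>R k s" for s
      using x by (auto simp: indicator_def k_def w_def \<open>\<Omega> = _\<close>)
    have k': "integrable (lebesgue_on {x - b..x - a}) k"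
      "(\<integral>s. k s \<partial>lebesgue_on {x - b..x - a}) = K x"
      using k \<Omega>_meas
      by (simp_all add: integrable_restrict_space integral_restrict_space ind[symmetric] K_def
          k_def[symmetric])
    have kuy: "k (x - y) = D2 (x - y) (u y) (u' y)" if "y \<in> {a..b}" for y
      using that by (simp add: k_def v_def w_def clamped_simps)
    show "integrable (lebesgue_on {a..b}) (\<lambda>y. D2 (x - y) (u y) (u' y))"
      using lebesgue_on_interval_reflect_shift(1)[OF k'(1)]
      by (rule Bochner_Integration.integrable_cong[THEN iffD1, rotated 2]) (auto simp: kuy)
    show "(\<integral>y. D2 (x - y) (u y) (u' y) \<partial>lebesgue_on {a..b}) = K x"
      using lebesgue_on_interval_reflect_shift(2)[OF k'(1)] k'(2)
      by (subst Bochner_Integration.integral_cong[OF refl, of _ _ "\<lambda>y. k (x - y)"]) (auto simp: kuy)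
  qed

  have f_sec: "continuous_on {a - b..b - a} (\<lambda>s. f s z)" if "z \<in> W" for z
  proof -
    have "continuous_on {a - b..b - a} (\<lambda>s. (\<lambda>(s, z). f s z) (s, z))"
      by (rule continuous_on_compose2[OF f_cont])
        (use that in \<open>auto intro!: continuous_intros simp: \<open>\<Omega> = _\<close>\<close>)
    then show ?thesis by simp
  qed
  have ua: "u a \<in> W" and ub: "u b \<in> W"
    using u_W \<open>a < b\<close> by auto

  \<comment> \<open>The integral over \<open>[x - a, b - a]\<close> is split so that only upper endpoints depend on \<open>x\<close>.\<close>
  have U: "integrable (lebesgue_on {a..b}) (\<lambda>y. f (x - y) (u y))"
    "urysohn_conv a b f u x = H x - integral {a - b..x - b} (\<lambda>s. f s (u b))
      - (integral {a - b..b - a} (\<lambda>s. f s (u a)) - integral {a - b..x - a} (\<lambda>s. f s (u a)))"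
    if x: "x \<in> {a..b}" for x
  proof -
    define h where "h s = f s (v (x - s))" for s
    have h: "continuous_on {a - b..b - a} h"
      unfolding h_def by (rule core)
    have h': "integrable (lebesgue_on {x - b..x - a}) h"
      by (rule continuous_imp_integrable_real, rule continuous_on_subset[OF h]) (use x in auto)
    have hy: "h (x - y) = f (x - y) (u y)" if "y \<in> {a..b}" for y
      using that by (simp add: h_def v_def clamped_simps)
    show "integrable (lebesgue_on {a..b}) (\<lambda>y. f (x - y) (u y))"
      using lebesgue_on_interval_reflect_shift(1)[OF h']
      by (rule Bochner_Integration.integrable_cong[THEN iffD1, rotated 2]) (auto simp: hy)
    have "urysohn_conv a b f u x = (\<integral>s. h s \<partial>lebesgue_on {x - b..x - a})"
      unfolding urysohn_conv_def using lebesgue_on_interval_reflect_shift(2)[OF h']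
      by (subst Bochner_Integration.integral_cong[OF refl, of _ _ "\<lambda>y. h (x - y)"]) (auto simp: hy)
    also have "\<dots> = integral {x - b..x - a} h"
      using h' by (simp add: lebesgue_integral_eq_integral)
    also have "\<dots> = integral {a - b..b - a} h - integral {a - b..x - b} h - integral {x - a..b - a} h"
    proof -
      have int: "h integrable_on {a - b..b - a}"
        using h by (rule integrable_continuous_real)
      then have "h integrable_on {a - b..x - a}"
        by (rule integrable_on_subinterval) (use x in auto)
      then have e1: "integral {a - b..x - b} h + integral {x - b..x - a} h = integral {a - b..x - a} h"
        using x \<open>a < b\<close> by (intro Henstock_Kurzweil_Integration.integral_combine) auto
      have e2:
        "integral {a - b..x - a} h + integral {x - a..b - a} h = integral {a - b..b - a} h"
        using x \<open>a < b\<close> int by (intro Henstock_Kurzweil_Integration.integral_combine) auto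
      show ?thesis
        unfolding e2[symmetric] e1[symmetric] by (simp add: algebra_simps)
    qed
    also have "integral {a - b..b - a} h = H x"
      using continuous_imp_integrable_real[OF h]
      by (simp add: H_def h_def[abs_def] \<open>\<Omega> = _\<close> lebesgue_integral_eq_integral)
    \<comment> \<open>Left of \<open>x - b\<close> the argument \<open>x - s\<close> is beyond \<open>b\<close>, right of \<open>x - a\<close> it is before \<open>a\<close>.\<close>
    also have "integral {a - b..x - b} h = integral {a - b..x - b} (\<lambda>s. f s (u b))"
      using \<open>a < b\<close> by (intro integral_cong) (auto simp: h_def v_def clamped_simps)
    also have "integral {x - a..b - a} h = integral {x - a..b - a} (\<lambda>s. f s (u a))"
      using \<open>a < b\<close> by (intro integral_cong) (auto simp: h_def v_def clamped_simps)
    also have "\<dots> = integral {a - b..b - a} (\<lambda>s. f s (u a)) - integral {a - b..x - a} (\<lambda>s. f s (u a))"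
    proof -
      have "(\<lambda>s. f s (u a)) integrable_on {a - b..b - a}"
        by (rule integrable_continuous_real[OF f_sec[OF ua]])
      then show ?thesis
        using Henstock_Kurzweil_Integration.integral_combine[of "a - b" "x - a" "b - a"
            "\<lambda>s. f s (u a)"] x \<open>a < b\<close>
        by (simp add: eq_diff_eq add.commute)
    qed
    finally show "urysohn_conv a b f u x = H x - integral {a - b..x - b} (\<lambda>s. f s (u b))
      - (integral {a - b..b - a} (\<lambda>s. f s (u a)) - integral {a - b..x - a} (\<lambda>s. f s (u a)))" .
  qed

  define G where "G x = f (x - a) (u a) - f (x - b) (u b) + K x" for x
  have U_der: "(urysohn_conv a b f u has_vector_derivative G x) (at x within {a..b})"
    if x: "x \<in> {a..b}" for x
  proof (rule has_vector_derivative_transform[OF x U(2)])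
    have "(H has_vector_derivative K x) (at x within {a..b})"
      using core(3)[of x] unfolding H_def[abs_def] K_def \<open>\<Omega> = _\<close>
      by (rule has_vector_derivative_at_within)
    moreover have "((\<lambda>x. integral {a - b..x - b} (\<lambda>s. f s (u b))) has_vector_derivative f (x - b) (u b))
        (at x within {a..b})"
      by (rule integral_shifted_endpoint_derivative[OF f_sec[OF ub] x]) (use \<open>a < b\<close> in auto)
    moreover have "((\<lambda>x. integral {a - b..x - a} (\<lambda>s. f s (u a))) has_vector_derivative f (x - a) (u a))
        (at x within {a..b})"
      by (rule integral_shifted_endpoint_derivative[OF f_sec[OF ua] x]) (use \<open>a < b\<close> in auto)
    ultimately show "((\<lambda>x. H x - integral {a - b..x - b} (\<lambda>s. f s (u b))
        - (integral {a - b..b - a} (\<lambda>s. f s (u a)) - integral {a - b..x - a} (\<lambda>s. f s (u a))))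
        has_vector_derivative G x) (at x within {a..b})"
      by (auto intro!: derivative_eq_intros simp: G_def)
  qed
  have "C1_on_interval a b (urysohn_conv a b f u)"
    unfolding C1_on_interval_def
  proof (intro conjI ballI)
    show "urysohn_conv a b f u differentiable at x within {a..b}" if "x \<in> {a..b}" for x
      using U_der[OF that] by (rule differentiableI_vector)
    have "continuous_on {a..b} G"
      unfolding G_def
    proof (intro continuous_intros)
      show "continuous_on {a..b} K"
        using core(4) unfolding K_def \<open>\<Omega> = _\<close> by (rule continuous_on_subset) auto
      show "continuous_on {a..b} (\<lambda>x. f (x - a) (u a))"
        by (rule continuous_on_compose2[OF f_sec[OF ua]]) (auto intro!: continuous_intros)
      show "continuous_on {a..b} (\<lambda>x. f (x - b) (u b))"
        by (rule continuous_on_compose2[OF f_sec[OF ub]]) (auto intro!: continuous_intros)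
    qed
    then show "continuous_on {a..b}
        (\<lambda>x. vector_derivative (urysohn_conv a b f u) (at x within {a..b}))"
      by (rule continuous_on_eq)
        (rule vector_derivative_within_closed_interval[OF \<open>a < b\<close> _ U_der, symmetric])
  qed
  then show ?thesis
    using U(1) K U_der by (simp add: G_def u'_def)
qed

end
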